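(* Let $(\mathfrak{g},\delta_\mathfrak{g})$ be a Lie coalgebra over $k$, $E$ a vector space containing $\mathfrak{g}$ as a subspace and $V$ a complement of $\mathfrak{g}$ in $E$. Put $\mathcal{HC}^2_\mathfrak{g}(V,\mathfrak{g}):=\mathcal{LC}(\mathfrak{g},V)/\equiv$. Then the map $$\mathcal{HC}^2_\mathfrak{g}(V,\mathfrak{g})\to CExtd(E,\mathfrak{g}),$$ sending the equivalence class of a Lie coalgebraic extending structure $\Omega^c(\mathfrak{g},\delta_\mathfrak{g},V)$ to the equivalence class of the unified co-product $(\mathfrak{g}\natural^cV,\delta_E)$ (a Lie coalgebra structure on $E=\mathfrak{g}\oplus V$), is bijective.
   Context: $k$ is a field of characteristic $0$; all vector spaces and (multi)linear maps are over $k$. $I$ denotes the identity map. A Lie coalgebra $(\mathfrak{g},\delta_\mathfrak{g})$ is a vector space $\mathfrak{g}$ with a linear map $\delta_\mathfrak{g}:\mathfrak{g}\to\mathfrak{g}\otimes\mathfrak{g}$ such that $\delta_\mathfrak{g}=-\tau\delta_\mathfrak{g}$ and $(I\otimes\delta_\mathfrak{g})\delta_\mathfrak{g}-\tau_{12}(I\otimes\delta_\mathfrak{g})\delta_\mathfrak{g}=(\delta_\mathfrak{g}\otimes I)\delta_\mathfrak{g}$, where $\tau(a\otimes b)=b\otimes a$ and $\tau_{12}(a\otimes b\otimes c)=b\otimes a\otimes c$. A homomorphism of Lie coalgebras is a linear map $\varphi$ with $\delta\varphi=(\varphi\otimes\varphi)\delta$. $(\mathfrak{g},\delta_\mathfrak{g})$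 is a Lie sub-coalgebra of $(E,\delta_E)$ if $\mathfrak{g}\subseteq E$ is a subspace and $\delta_E|_\mathfrak{g}=\delta_\mathfrak{g}$. $CExtd(E,\mathfrak{g})$: the set of equivalence classes of Lie coalgebra structures $\delta_E$ on $E$ containing $(\mathfrak{g},\delta_\mathfrak{g})$ as a Lie sub-coalgebra, where $(E,\delta_E)\equiv(E,\delta_E')$ if there is an isomorphism of Lie coalgebras $(E,\delta_E)\to(E,\delta_E')$ whose restriction to $\mathfrak{g}$ is the identity. An extending datum of $(\mathfrak{g},\delta_\mathfrak{g})$ by $V$ is a triple $(\Delta_E,\Delta_V,\delta_V)$ of linear maps $\Delta_E:V\to\mathfrak{g}\otimes V$, $\Delta_V:V\to\mathfrak{g}\otimes\mathfrak{g}$, $\delta_V:V\to V\otimes V$. Given such a datum, $\mathfrak{g}\natural^cV$ denotes $E=\mathfrak{g}\oplus V$ with $\delta_E(a+x)=\delta_\mathfrak{g}(a)+\Delta_E(x)-\tau\Delta_E(x)+\Delta_V(x)+\delta_V(x)$ for $a\in\mathfrak{g}$, $x\in V$. If this is a Lie coalgebra, it is called the unified co-product and the datum is called a Lie coalgebraic extending structure of $(\mathfrak{g},\delta_\mathfrak{g})$ by $V$. $\mathcal{LC}(\mathfrak{g},V)$ is the set of all Lie coalgebraic extending structures. Two elements $(\Delta_E,\Delta_V,\delta_V)$ and $(\Delta_E',\Delta_V',\delta_V')$ of $\mathcal{LC}(\mathfrak{g},V)$ are equivalent ($\equiv$) if there are a linear map $p:V\to\mathfrak{g}$ and a linear automorphism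 $q$ of $V$ such that for all $x\in V$: $\delta_V'(x)=(q\otimes q)\delta_V(q^{-1}(x))$; $\Delta_E'(x)=(I\otimes q)\Delta_E(q^{-1}(x))+(p\otimes q)\delta_V(q^{-1}(x))$; $\Delta_V'(x)=(I\otimes p)\Delta_E(q^{-1}(x))-(p\otimes I)\tau\Delta_E(q^{-1}(x))+(p\otimes p)\delta_V(q^{-1}(x))+\Delta_V(q^{-1}(x))-\delta_\mathfrak{g}(p(q^{-1}(x)))$. *)

theory Defs
  imports "HOL.Vector_Spaces" "HOL-Library.FuncSet" "HOL-Library.Function_Algebras"
begin

text \<open>
  Vector spaces are given by the library locale \<open>vector_space\<close>; a Lie coalgebra lives on a subspace
  \<open>A\<close> of an ambient vector space (possibly all of it, \<open>A = UNIV\<close>).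

  The libraries have no tensor product of vector spaces over an arbitrary field. The usual embedding
  of \<open>E \<otimes> F\<close> into the bilinear forms on \<open>E\<^sup>* \<times> F\<^sup>*\<close> is used as a model: \<open>x \<otimes> y\<close> is the form
  \<open>(f, h) \<mapsto> f x * h y\<close>, and a tensor is a finite sum of those. The universal property is proved below
  (\<open>tensor_lift_zero\<close>, \<open>tlift_sum\<close>, \<open>linear_on_tlift\<close>, \<open>tlift_unique\<close>, and \<open>tensor3_lift_zero\<close>
  for three factors). For subspaces \<open>A\<close>, \<open>B\<close> of \<open>E\<close> the tensor product \<open>A \<otimes> B\<close> is thereby
  identified, as always over a field, with the corresponding subspace of \<open>E \<otimes> E\<close>.
\<close>

type_synonym ('k, 'e) tensor2 = "('e \<Rightarrow> 'k) \<Rightarrow> ('e \<Rightarrow> 'k) \<Rightarrow> 'k"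
type_synonym ('k, 'e) tensor3 = "('e \<Rightarrow> 'k) \<Rightarrow> ('e \<Rightarrow> 'k) \<Rightarrow> ('e \<Rightarrow> 'k) \<Rightarrow> 'k"

type_synonym ('k, 'e) datum =
  "('e \<Rightarrow> ('k, 'e) tensor2) \<times> ('e \<Rightarrow> ('k, 'e) tensor2) \<times> ('e \<Rightarrow> ('k, 'e) tensor2)"

definition scale2 :: "'k::times \<Rightarrow> ('k, 'e) tensor2 \<Rightarrow> ('k, 'e) tensor2" where
  "scale2 c t = (\<lambda>f h. c * t f h)"

definition scale3 :: "'k::times \<Rightarrow> ('k, 'e) tensor3 \<Rightarrow> ('k, 'e) tensor3" where
  "scale3 c t = (\<lambda>f h l. c * t f h l)"

text \<open>\<open>\<tau>(a \<otimes> b) = b \<otimes> a\<close> and \<open>\<tau>\<^sub>1\<^sub>2(a \<otimes> b \<otimes> c) = b \<otimes> a \<otimes> c\<close>; see \<open>swap_tensor\<close>, \<open>swap12_tensor\<close>.\<close>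

definition swap :: "('k, 'e) tensor2 \<Rightarrow> ('k, 'e) tensor2" where
  "swap t = (\<lambda>f h. t h f)"

definition swap12 :: "('k, 'e) tensor3 \<Rightarrow> ('k, 'e) tensor3" where
  "swap12 t = (\<lambda>f h l. t h f l)"

lemma vector_space_scale2: "vector_space (scale2 :: 'k::field \<Rightarrow> ('k, 'e) tensor2 \<Rightarrow> _)"
  by unfold_locales (simp_all add: scale2_def fun_eq_iff algebra_simps)

lemma vector_space_scale3: "vector_space (scale3 :: 'k::field \<Rightarrow> ('k, 'e) tensor3 \<Rightarrow> _)"
  by unfold_locales (simp_all add: scale3_def fun_eq_iff algebra_simps)

lemma vector_space_mult: "vector_space ((*) :: 'k::field \<Rightarrow> 'k \<Rightarrow> 'k)"
  by unfold_locales (simp_all add: algebra_simps)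

context vector_space
begin

definition linear_on :: "'b set \<Rightarrow> ('a \<Rightarrow> 'c::plus \<Rightarrow> 'c) \<Rightarrow> ('b \<Rightarrow> 'c) \<Rightarrow> bool" where
  "linear_on A s f \<longleftrightarrow>
     (\<forall>x\<in>A. \<forall>y\<in>A. f (x + y) = f x + f y) \<and> (\<forall>c. \<forall>x\<in>A. f (scale c x) = s c (f x))"

definition bilinear_on :: "'b set \<Rightarrow> 'b set \<Rightarrow> ('a \<Rightarrow> 'c::plus \<Rightarrow> 'c) \<Rightarrow> ('b \<Rightarrow> 'b \<Rightarrow> 'c) \<Rightarrow> bool" where
  "bilinear_on A B s \<beta> \<longleftrightarrow>
     (\<forall>a\<in>A. linear_on B s (\<beta> a)) \<and> (\<forall>b\<in>B. linear_on A s (\<lambda>a. \<beta> a b))"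

text \<open>Functions on a subspace are normalised to be \<open>undefined\<close> outside it, so that the following is
  the set of linear maps \<open>A \<rightarrow> W\<close>.\<close>

definition lin_maps :: "('a \<Rightarrow> 'c::plus \<Rightarrow> 'c) \<Rightarrow> 'b set \<Rightarrow> 'c set \<Rightarrow> ('b \<Rightarrow> 'c) set" where
  "lin_maps s A W = {f \<in> A \<rightarrow>\<^sub>E W. linear_on A s f}"

definition dual :: "('b \<Rightarrow> 'a) set" where
  "dual = {f. Vector_Spaces.linear scale (*) f}"

definition ev :: "'b \<Rightarrow> ('b \<Rightarrow> 'a) \<Rightarrow> 'a" where
  "ev x f = (if f \<in> dual then f x else 0)"

definition tensor :: "'b \<Rightarrow> 'b \<Rightarrow> ('a, 'b) tensor2" (infix "\<otimes>" 75) where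
  "x \<otimes> y = (\<lambda>f h. ev x f * ev y h)"

text \<open>The products \<open>E \<times> (E \<otimes> E) \<rightarrow> E \<otimes> E \<otimes> E\<close> and \<open>(E \<otimes> E) \<times> E \<rightarrow> E \<otimes> E \<otimes> E\<close>.\<close>

definition tensor_left :: "'b \<Rightarrow> ('a, 'b) tensor2 \<Rightarrow> ('a, 'b) tensor3" (infix "\<otimes>\<^sub>l" 75) where
  "x \<otimes>\<^sub>l t = (\<lambda>f h l. ev x f * t h l)"

definition tensor_right :: "('a, 'b) tensor2 \<Rightarrow> 'b \<Rightarrow> ('a, 'b) tensor3" (infix "\<otimes>\<^sub>r" 75) where
  "t \<otimes>\<^sub>r z = (\<lambda>f h l. t f h * ev z l)"

definition tensor_space :: "'b set \<Rightarrow> 'b set \<Rightarrow> ('a, 'b) tensor2 set" where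
  "tensor_space A B = {(\<Sum>(a, b)\<leftarrow>xs. a \<otimes> b) | xs. set xs \<subseteq> A \<times> B}"

text \<open>The linear map on \<open>A \<otimes> B\<close> induced by a bilinear map \<open>\<beta>\<close> on \<open>A \<times> B\<close>.\<close>

definition tlift :: "'b set \<Rightarrow> 'b set \<Rightarrow> ('b \<Rightarrow> 'b \<Rightarrow> 'c::ab_group_add) \<Rightarrow> ('a, 'b) tensor2 \<Rightarrow> 'c" where
  "tlift A B \<beta> t = (THE w. \<exists>xs. set xs \<subseteq> A \<times> B \<and>
     t = (\<Sum>(a, b)\<leftarrow>xs. a \<otimes> b) \<and> w = (\<Sum>(a, b)\<leftarrow>xs. \<beta> a b))"

definition tensor_map ::
    "'b set \<Rightarrow> 'b set \<Rightarrow> ('b \<Rightarrow> 'b) \<Rightarrow> ('b \<Rightarrow> 'b) \<Rightarrow> ('a, 'b) tensor2 \<Rightarrow> ('a, 'b) tensor2" where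
  "tensor_map A B \<phi> \<psi> = tlift A B (\<lambda>a b. \<phi> a \<otimes> \<psi> b)"


subsection \<open>The universal property\<close>

lemma swap_tensor: "swap (x \<otimes> y) = y \<otimes> x"
  by (simp add: swap_def tensor_def fun_eq_iff)

lemma tensor_assoc: "x \<otimes>\<^sub>l (y \<otimes> z) = (x \<otimes> y) \<otimes>\<^sub>r z"
  by (simp add: tensor_left_def tensor_right_def tensor_def fun_eq_iff)

lemma swap12_tensor: "swap12 (x \<otimes>\<^sub>l (y \<otimes> z)) = y \<otimes>\<^sub>l (x \<otimes> z)"
  by (simp add: tensor_left_def swap12_def tensor_def fun_eq_iff)

lemma ev_add: "ev (x + y) f = ev x f + ev y f"
  by (auto simp: ev_def dual_def Vector_Spaces.linear_iff)

lemma ev_scale: "ev (scale c x) f = c * ev x f"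
  by (auto simp: ev_def dual_def Vector_Spaces.linear_iff)

lemma bilinear_on_tensor: "bilinear_on A B scale2 (\<otimes>)"
  by (auto simp: bilinear_on_def linear_on_def tensor_def ev_add ev_scale scale2_def
      fun_eq_iff algebra_simps)

lemma linear_on_sum_list:
  assumes A: "subspace A" and s: "vector_space s" and f: "linear_on A s f" and "set xs \<subseteq> A"
  shows "sum_list xs \<in> A \<and> f (sum_list xs) = (\<Sum>x\<leftarrow>xs. f x)"
  using assms(4)
proof (induction xs)
  case Nil
  interpret s: vector_space s by fact
  have "f (scale 0 0) = s 0 (f 0)"
    using f subspace_0[OF A] unfolding linear_on_def by blast
  then show ?case by (simp add: subspace_0[OF A])
next
  case (Cons x xs)
  then show ?case using f subspace_add[OF A] by (auto simp: linear_on_def)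
qed

lemma representation_in_dual:
  assumes "independent U" "span U = UNIV"
  shows "(\<lambda>v. representation U v e) \<in> dual"
  using assms
  by (auto simp: dual_def Vector_Spaces.linear_iff representation_add representation_scale
      vector_space_axioms vector_space_mult)

lemma dual_separates:
  assumes "\<And>f. f \<in> dual \<Longrightarrow> f y = 0"
  shows "y = 0"
proof (rule ccontr)
  assume "y \<noteq> 0"
  then have ind: "independent {y}" by simp
  let ?U = "extend_basis {y}"
  have U: "independent ?U" "span ?U = UNIV" "y \<in> ?U"
    using independent_extend_basis[OF ind] span_extend_basis[OF ind] extend_basis_superset[OF ind]
    by auto
  have "representation ?U y y = 0"
    using assms[OF representation_in_dual[OF U(1,2)]] .
  then show False using representation_basis[OF U(1,3)] by simp
qed

lemma sum_list_apply: "(\<Sum>x\<leftarrow>xs. F x) y = (\<Sum>x\<leftarrow>xs. F x y)"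
  by (induction xs) auto

lemma sum_list_sum_commute:
  "(\<Sum>x\<leftarrow>xs. \<Sum>e\<in>S. F x e) = (\<Sum>e\<in>S. \<Sum>x\<leftarrow>xs. F x e :: 'c::comm_monoid_add)"
  by (induction xs) (auto simp: sum.distrib)

lemma linear_on_sum:
  assumes A: "subspace A" and s: "vector_space s" and f: "linear_on A s f"
    and "finite S" "\<And>i. i \<in> S \<Longrightarrow> F i \<in> A"
  shows "f (sum F S) = (\<Sum>i\<in>S. f (F i))"
  using assms(4,5)
proof (induction S rule: finite_induct)
  case empty
  show ?case using linear_on_sum_list[OF A s f, of "[]"] by simp
next
  case (insert i S)
  have "f (F i + sum F S) = f (F i) + f (sum F S)"
    using f insert.prems subspace_sum[OF A, of S F] by (auto simp: linear_on_def)
  then show ?case using insert by simp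
qed

lemma coordinates:
  assumes A: "subspace A" and "finite S" "S \<subseteq> A"
  obtains Bs \<pi> where "finite Bs" "Bs \<subseteq> A" "\<And>e. \<pi> e \<in> dual"
    "\<And>a. a \<in> S \<Longrightarrow> a = (\<Sum>e\<in>Bs. scale (\<pi> e a) e)"
proof -
  obtain Bs where Bs: "Bs \<subseteq> S" "independent Bs" "S \<subseteq> span Bs"
    using maximal_independent_subset by blast
  let ?U = "extend_basis Bs"
  have fin: "finite Bs" using Bs assms finite_subset by blast
  have U: "independent ?U" "span ?U = UNIV" "Bs \<subseteq> ?U"
    using independent_extend_basis[OF Bs(2)] span_extend_basis[OF Bs(2)]
      extend_basis_superset[OF Bs(2)] by auto
  have "a = (\<Sum>e\<in>Bs. scale (representation ?U a e) e)" if "a \<in> S" for a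
  proof -
    have a: "a \<in> span Bs" using that Bs by blast
    have "(\<Sum>e\<in>Bs. scale (representation Bs a e) e) = a"
      by (rule sum_representation_eq) (use Bs fin a in auto)
    then show ?thesis using representation_extend[OF U(1) a U(3)] by simp
  qed
  then show ?thesis
    using that[of Bs "\<lambda>e v. representation ?U v e"] fin Bs assms representation_in_dual[OF U(1,2)]
    by auto
qed

text \<open>A relation between pure tensors is respected by every bilinear map, into any vector space.\<close>

lemma tensor_lift_zero:
  assumes A: "subspace A" and B: "subspace B" and s: "vector_space s"
    and \<beta>: "bilinear_on A B s \<beta>" and xs: "set xs \<subseteq> A \<times> B"
    and 0: "(\<Sum>(a, b)\<leftarrow>xs. a \<otimes> b) = 0"
  shows "(\<Sum>(a, b)\<leftarrow>xs. \<beta> a b) = 0"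
proof -
  interpret s: vector_space s by fact
  have fst_xs: "finite (fst ` set xs)" "fst ` set xs \<subseteq> A" using xs by auto
  obtain Bs \<pi> where Bs: "finite Bs" "Bs \<subseteq> A" and \<pi>: "\<And>e. \<pi> e \<in> dual"
    and co: "\<And>a. a \<in> fst ` set xs \<Longrightarrow> a = (\<Sum>e\<in>Bs. scale (\<pi> e a) e)"
    by (rule coordinates[OF A fst_xs]) (rule that)
  have vanish: "(\<Sum>(a, b)\<leftarrow>xs. scale (\<pi> e a) b) = 0" for e
  proof (rule dual_separates)
    fix f assume f: "f \<in> dual"
    then have lin: "linear_on UNIV (*) f"
      by (auto simp: dual_def linear_on_def Vector_Spaces.linear_iff)
    have "f (\<Sum>(a, b)\<leftarrow>xs. scale (\<pi> e a) b) = (\<Sum>(a, b)\<leftarrow>xs. \<pi> e a * f b)"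
      using linear_on_sum_list[OF subspace_UNIV vector_space_mult lin,
          of "map (\<lambda>(a, b). scale (\<pi> e a) b) xs"] lin
      by (auto simp: linear_on_def o_def case_prod_unfold)
    also have "\<dots> = (\<Sum>(a, b)\<leftarrow>xs. a \<otimes> b) (\<pi> e) f"
      by (simp add: sum_list_apply case_prod_unfold tensor_def ev_def f \<pi>)
    finally show "f (\<Sum>(a, b)\<leftarrow>xs. scale (\<pi> e a) b) = 0" using 0 by simp
  qed
  have expand: "\<beta> a b = (\<Sum>e\<in>Bs. \<beta> e (scale (\<pi> e a) b))" if "(a, b) \<in> set xs" for a b
  proof -
    have ab: "a \<in> A" "b \<in> B" using that xs by auto
    have l: "linear_on A s (\<lambda>a. \<beta> a b)" using \<beta> ab by (auto simp: bilinear_on_def)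
    have "a = (\<Sum>e\<in>Bs. scale (\<pi> e a) e)" using co[of a] that by force
    then have "\<beta> a b = \<beta> (\<Sum>e\<in>Bs. scale (\<pi> e a) e) b" by simp
    also have "\<dots> = (\<Sum>e\<in>Bs. \<beta> (scale (\<pi> e a) e) b)"
      by (rule linear_on_sum[OF A s l]) (use Bs subspace_scale[OF A] in auto)
    also have "\<dots> = (\<Sum>e\<in>Bs. \<beta> e (scale (\<pi> e a) b))"
    proof (rule sum.cong[OF refl])
      fix e assume "e \<in> Bs"
      then have "e \<in> A" using Bs by auto
      then show "\<beta> (scale (\<pi> e a) e) b = \<beta> e (scale (\<pi> e a) b)"
        using \<beta> ab by (auto simp: bilinear_on_def linear_on_def)
    qed
    finally show ?thesis .
  qed
  have "(\<Sum>(a, b)\<leftarrow>xs. \<beta> a b) = (\<Sum>(a, b)\<leftarrow>xs. \<Sum>e\<in>Bs. \<beta> e (scale (\<pi> e a) b))"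
    using expand by (auto intro!: arg_cong[where f = sum_list] map_cong)
  also have "\<dots> = (\<Sum>e\<in>Bs. \<Sum>(a, b)\<leftarrow>xs. \<beta> e (scale (\<pi> e a) b))"
    by (simp add: case_prod_unfold sum_list_sum_commute)
  also have "\<dots> = (\<Sum>e\<in>Bs. 0)"
  proof (rule sum.cong[OF refl])
    fix e assume "e \<in> Bs"
    then have l: "linear_on B s (\<beta> e)" using Bs \<beta> by (auto simp: bilinear_on_def)
    have m: "set (map (\<lambda>(a, b). scale (\<pi> e a) b) xs) \<subseteq> B"
      using xs subspace_scale[OF B] by auto
    have "\<beta> e (\<Sum>(a, b)\<leftarrow>xs. scale (\<pi> e a) b) = (\<Sum>(a, b)\<leftarrow>xs. \<beta> e (scale (\<pi> e a) b))"
      using linear_on_sum_list[OF B s l m] by (simp add: o_def case_prod_unfold)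
    moreover have "\<beta> e 0 = 0" using linear_on_sum_list[OF B s l, of "[]"] by simp
    ultimately show "(\<Sum>(a, b)\<leftarrow>xs. \<beta> e (scale (\<pi> e a) b)) = 0" using vanish[of e] by simp
  qed
  finally show ?thesis by simp
qed

lemma tlift_sum:
  assumes A: "subspace A" and B: "subspace B" and s: "vector_space s"
    and \<beta>: "bilinear_on A B s \<beta>" and xs: "set xs \<subseteq> A \<times> B"
  shows "tlift A B \<beta> (\<Sum>(a, b)\<leftarrow>xs. a \<otimes> b) = (\<Sum>(a, b)\<leftarrow>xs. \<beta> a b)"
  unfolding tlift_def
proof (rule the_equality)
  fix w assume "\<exists>ys. set ys \<subseteq> A \<times> B \<and> (\<Sum>(a, b)\<leftarrow>xs. a \<otimes> b) = (\<Sum>(a, b)\<leftarrow>ys. a \<otimes> b) \<and>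
    w = (\<Sum>(a, b)\<leftarrow>ys. \<beta> a b)"
  then obtain ys where ys: "set ys \<subseteq> A \<times> B"
    "(\<Sum>(a, b)\<leftarrow>xs. a \<otimes> b) = (\<Sum>(a, b)\<leftarrow>ys. a \<otimes> b)" "w = (\<Sum>(a, b)\<leftarrow>ys. \<beta> a b)" by blast
  let ?n = "map (\<lambda>(a, b). (a, scale (- 1) b)) ys"
  have neg: "(\<Sum>(a, b)\<leftarrow>?n. \<gamma> a b) = - (\<Sum>(a, b)\<leftarrow>ys. \<gamma> a b)"
    if \<gamma>: "bilinear_on A B s' \<gamma>" and s': "vector_space s'" for s' and \<gamma> :: "'b \<Rightarrow> 'b \<Rightarrow> 'd::ab_group_add"
  proof -
    interpret s': vector_space s' by fact
    have "\<gamma> a (scale (- 1) b) = - \<gamma> a b" if "(a, b) \<in> set ys" for a b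
    proof -
      have "\<gamma> a (scale (- 1) b) = s' (- 1) (\<gamma> a b)"
        using \<gamma> that ys(1) unfolding bilinear_on_def linear_on_def by blast
      then show ?thesis by simp
    qed
    then show ?thesis by (induction ys) (auto simp del: scale_minus_left)
  qed
  have "(\<Sum>(a, b)\<leftarrow>xs @ ?n. a \<otimes> b) = 0"
    using neg[OF bilinear_on_tensor vector_space_scale2] ys(2) by simp
  then have "(\<Sum>(a, b)\<leftarrow>xs @ ?n. \<beta> a b) = 0"
    by (intro tensor_lift_zero[OF A B s \<beta>]) (use xs ys subspace_neg[OF B] in auto)
  then show "w = (\<Sum>(a, b)\<leftarrow>xs. \<beta> a b)" using neg[OF \<beta> s] ys(3) by simp
qed (use xs in blast)

lemma tlift_tensor:
  assumes "subspace A" "subspace B" "vector_space s" "bilinear_on A B s \<beta>" "a \<in> A" "b \<in> B"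
  shows "tlift A B \<beta> (a \<otimes> b) = \<beta> a b"
  using tlift_sum[OF assms(1-4), of "[(a, b)]"] assms(5,6) by simp

lemma tensor_space_add:
  "t \<in> tensor_space A B \<Longrightarrow> u \<in> tensor_space A B \<Longrightarrow> t + u \<in> tensor_space A B"
  unfolding tensor_space_def
proof clarify
  fix xs ys assume "set xs \<subseteq> A \<times> B" "set ys \<subseteq> A \<times> B"
  then show "\<exists>zs. (\<Sum>(a, b)\<leftarrow>xs. a \<otimes> b) + (\<Sum>(a, b)\<leftarrow>ys. a \<otimes> b) = (\<Sum>(a, b)\<leftarrow>zs. a \<otimes> b) \<and>
      set zs \<subseteq> A \<times> B"
    by (intro exI[of _ "xs @ ys"]) auto
qed

lemma sum_list_scale_fst:
  assumes s: "vector_space s" and \<beta>: "bilinear_on A B s \<beta>" and xs: "set xs \<subseteq> A \<times> B"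
  shows "(\<Sum>(a, b)\<leftarrow>map (\<lambda>(a, b). (scale c a, b)) xs. \<beta> a b) = s c (\<Sum>(a, b)\<leftarrow>xs. \<beta> a b)"
  using xs
proof (induction xs)
  case Nil
  interpret s: vector_space s by fact
  show ?case by simp
next
  case (Cons x xs)
  interpret s: vector_space s by fact
  obtain a b where x: "x = (a, b)" by force
  have "\<beta> (scale c a) b = s c (\<beta> a b)"
    using \<beta> Cons.prems x by (auto simp: bilinear_on_def linear_on_def)
  then show ?case using Cons x by (simp add: s.scale_right_distrib)
qed

lemma tensor_space_scale:
  assumes A: "subspace A" and t: "t \<in> tensor_space A B"
  shows "scale2 c t \<in> tensor_space A B"
proof -
  obtain xs where xs: "set xs \<subseteq> A \<times> B" "t = (\<Sum>(a, b)\<leftarrow>xs. a \<otimes> b)"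
    using t by (auto simp: tensor_space_def)
  then have "scale2 c t = (\<Sum>(a, b)\<leftarrow>map (\<lambda>(a, b). (scale c a, b)) xs. a \<otimes> b)"
    using sum_list_scale_fst[OF vector_space_scale2 bilinear_on_tensor xs(1)] by simp
  moreover have "set (map (\<lambda>(a, b). (scale c a, b)) xs) \<subseteq> A \<times> B"
    using xs subspace_scale[OF A] by auto
  ultimately show ?thesis unfolding tensor_space_def by blast
qed

lemma linear_on_tlift:
  assumes A: "subspace A" and B: "subspace B" and s: "vector_space s"
    and \<beta>: "bilinear_on A B s \<beta>"
  shows "vector_space.linear_on scale2 (tensor_space A B) s (tlift A B \<beta>)"
proof -
  interpret T: vector_space "scale2 :: 'a \<Rightarrow> ('a, 'b) tensor2 \<Rightarrow> _" by (rule vector_space_scale2)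
  show ?thesis
    unfolding T.linear_on_def
  proof (intro conjI ballI allI)
    fix t u assume "t \<in> tensor_space A B" "u \<in> tensor_space A B"
    then obtain xs ys where *: "set xs \<subseteq> A \<times> B" "t = (\<Sum>(a, b)\<leftarrow>xs. a \<otimes> b)"
      "set ys \<subseteq> A \<times> B" "u = (\<Sum>(a, b)\<leftarrow>ys. a \<otimes> b)"
      by (auto simp: tensor_space_def)
    then have "t + u = (\<Sum>(a, b)\<leftarrow>xs @ ys. a \<otimes> b)" by simp
    moreover have "tlift A B \<beta> (\<Sum>(a, b)\<leftarrow>xs @ ys. a \<otimes> b) = (\<Sum>(a, b)\<leftarrow>xs @ ys. \<beta> a b)"
      by (rule tlift_sum[OF assms]) (use * in auto)
    ultimately show "tlift A B \<beta> (t + u) = tlift A B \<beta> t + tlift A B \<beta> u"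
      using tlift_sum[OF assms *(1)] tlift_sum[OF assms *(3)] * by simp
  next
    fix c t assume "t \<in> tensor_space A B"
    then obtain xs where xs: "set xs \<subseteq> A \<times> B" "t = (\<Sum>(a, b)\<leftarrow>xs. a \<otimes> b)"
      by (auto simp: tensor_space_def)
    let ?m = "map (\<lambda>(a, b). (scale c a, b)) xs"
    have "scale2 c t = (\<Sum>(a, b)\<leftarrow>?m. a \<otimes> b)"
      using sum_list_scale_fst[OF vector_space_scale2 bilinear_on_tensor xs(1)] xs(2) by simp
    moreover have "tlift A B \<beta> (\<Sum>(a, b)\<leftarrow>?m. a \<otimes> b) = (\<Sum>(a, b)\<leftarrow>?m. \<beta> a b)"
      by (rule tlift_sum[OF assms]) (use xs subspace_scale[OF A] in auto)
    moreover have "\<dots> = s c (\<Sum>(a, b)\<leftarrow>xs. \<beta> a b)"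
      by (rule sum_list_scale_fst[OF s \<beta> xs(1)])
    ultimately show "tlift A B \<beta> (scale2 c t) = s c (tlift A B \<beta> t)"
      using tlift_sum[OF assms xs(1)] xs(2) by simp
  qed
qed

lemma tensor_in_tensor_space: "a \<in> A \<Longrightarrow> b \<in> B \<Longrightarrow> a \<otimes> b \<in> tensor_space A B"
  unfolding tensor_space_def by (rule CollectI, rule exI[of _ "[(a, b)]"]) simp

lemma subspace_tensor_space:
  assumes A: "subspace A"
  shows "module.subspace scale2 (tensor_space A B)"
proof -
  interpret T: vector_space "scale2 :: 'a \<Rightarrow> ('a, 'b) tensor2 \<Rightarrow> _" by (rule vector_space_scale2)
  have "0 \<in> tensor_space A B"
    unfolding tensor_space_def by (rule CollectI, rule exI[of _ "[]"]) simp
  then show ?thesis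
    by (auto intro!: T.subspaceI tensor_space_add tensor_space_scale[OF A])
qed

lemma tlift_unique:
  assumes A: "subspace A" and B: "subspace B" and s: "vector_space s"
    and \<beta>: "bilinear_on A B s \<beta>"
    and L: "vector_space.linear_on scale2 (tensor_space A B) s L"
    and eq: "\<And>a b. a \<in> A \<Longrightarrow> b \<in> B \<Longrightarrow> L (a \<otimes> b) = \<beta> a b"
    and t: "t \<in> tensor_space A B"
  shows "L t = tlift A B \<beta> t"
proof -
  interpret T: vector_space "scale2 :: 'a \<Rightarrow> ('a, 'b) tensor2 \<Rightarrow> _" by (rule vector_space_scale2)
  obtain xs where xs: "set xs \<subseteq> A \<times> B" "t = (\<Sum>(a, b)\<leftarrow>xs. a \<otimes> b)"
    using t by (auto simp: tensor_space_def)
  have m: "set (map (\<lambda>(a, b). a \<otimes> b) xs) \<subseteq> tensor_space A B"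
    using xs tensor_in_tensor_space by auto
  have "L t = (\<Sum>(a, b)\<leftarrow>xs. L (a \<otimes> b))"
    using T.linear_on_sum_list[OF subspace_tensor_space[OF A] s L m] xs(2)
    by (simp add: o_def case_prod_unfold)
  also have "\<dots> = (\<Sum>(a, b)\<leftarrow>xs. \<beta> a b)"
    using xs(1) eq by (auto intro!: arg_cong[where f = sum_list] map_cong)
  finally show ?thesis using tlift_sum[OF A B s \<beta> xs(1)] xs(2) by simp
qed

lemma tensor3_lift_zero:
  assumes s: "vector_space s"
    and 1: "\<And>b c. linear_on UNIV s (\<lambda>a. \<gamma> a b c)"
    and 2: "\<And>a c. linear_on UNIV s (\<lambda>b. \<gamma> a b c)"
    and 3: "\<And>a b. linear_on UNIV s (\<lambda>c. \<gamma> a b c)"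
    and 0: "(\<Sum>(a, b, c)\<leftarrow>xs. a \<otimes>\<^sub>l (b \<otimes> c)) = 0"
  shows "(\<Sum>(a, b, c)\<leftarrow>xs. \<gamma> a b c) = 0"
proof -
  have fst_xs: "finite (fst ` set xs)" "fst ` set xs \<subseteq> UNIV" by auto
  obtain Bs \<pi> where Bs: "finite Bs" and \<pi>: "\<And>e. \<pi> e \<in> dual"
    and co: "\<And>a. a \<in> fst ` set xs \<Longrightarrow> a = (\<Sum>e\<in>Bs. scale (\<pi> e a) e)"
    by (rule coordinates[OF subspace_UNIV fst_xs]) (rule that)
  have vanish: "(\<Sum>(a, b, c)\<leftarrow>xs. \<gamma> e (scale (\<pi> e a) b) c) = 0" for e
  proof -
    let ?m = "map (\<lambda>(a, b, c). (scale (\<pi> e a) b, c)) xs"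
    have "(\<Sum>(b, c)\<leftarrow>?m. b \<otimes> c) f h = (\<Sum>(a, b, c)\<leftarrow>xs. a \<otimes>\<^sub>l (b \<otimes> c)) (\<pi> e) f h" for f h
      by (simp add: sum_list_apply o_def case_prod_unfold tensor_def tensor_left_def ev_scale
          ev_def[of _ "\<pi> e"] \<pi> mult.assoc)
    then have "(\<Sum>(b, c)\<leftarrow>?m. b \<otimes> c) = 0" using 0 by (simp add: fun_eq_iff)
    then have "(\<Sum>(b, c)\<leftarrow>?m. \<gamma> e b c) = 0"
      by (intro tensor_lift_zero[OF subspace_UNIV subspace_UNIV s, of "\<gamma> e"])
         (use 2 3 in \<open>auto simp: bilinear_on_def\<close>)
    then show ?thesis by (simp add: o_def case_prod_unfold)
  qed
  have expand: "\<gamma> a b c = (\<Sum>e\<in>Bs. \<gamma> e (scale (\<pi> e a) b) c)" if "(a, b, c) \<in> set xs" for a b c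
  proof -
    have "a = (\<Sum>e\<in>Bs. scale (\<pi> e a) e)" using co[of a] that by force
    then have "\<gamma> a b c = \<gamma> (\<Sum>e\<in>Bs. scale (\<pi> e a) e) b c" by simp
    also have "\<dots> = (\<Sum>e\<in>Bs. \<gamma> (scale (\<pi> e a) e) b c)"
      by (rule linear_on_sum[OF subspace_UNIV s 1]) (use Bs in auto)
    also have "\<dots> = (\<Sum>e\<in>Bs. \<gamma> e (scale (\<pi> e a) b) c)"
      using 1 2 by (auto simp: linear_on_def)
    finally show ?thesis .
  qed
  have "(\<Sum>(a, b, c)\<leftarrow>xs. \<gamma> a b c) = (\<Sum>(a, b, c)\<leftarrow>xs. \<Sum>e\<in>Bs. \<gamma> e (scale (\<pi> e a) b) c)"
    using expand by (auto intro!: arg_cong[where f = sum_list] map_cong)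
  also have "\<dots> = (\<Sum>e\<in>Bs. \<Sum>(a, b, c)\<leftarrow>xs. \<gamma> e (scale (\<pi> e a) b) c)"
    by (simp add: case_prod_unfold sum_list_sum_commute)
  finally show ?thesis using vanish by simp
qed


subsection \<open>Lie coalgebras\<close>

definition lie_coalgebra :: "'b set \<Rightarrow> ('b \<Rightarrow> ('a, 'b) tensor2) \<Rightarrow> bool" where
  "lie_coalgebra A \<delta> \<longleftrightarrow>
     subspace A \<and> linear_on A scale2 \<delta> \<and> \<delta> ` A \<subseteq> tensor_space A A \<and>
     (\<forall>x\<in>A. \<delta> x = - swap (\<delta> x)) \<and>
     (\<forall>x\<in>A. tlift A A (\<lambda>a b. a \<otimes>\<^sub>l \<delta> b) (\<delta> x) - swap12 (tlift A A (\<lambda>a b. a \<otimes>\<^sub>l \<delta> b) (\<delta> x))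
             = tlift A A (\<lambda>a b. \<delta> a \<otimes>\<^sub>r b) (\<delta> x))"

definition lie_coalgebra_hom ::
    "'b set \<Rightarrow> ('b \<Rightarrow> ('a, 'b) tensor2) \<Rightarrow> 'b set \<Rightarrow> ('b \<Rightarrow> ('a, 'b) tensor2) \<Rightarrow> ('b \<Rightarrow> 'b) \<Rightarrow> bool" where
  "lie_coalgebra_hom A \<delta> B \<delta>' \<phi> \<longleftrightarrow>
     linear_on A scale \<phi> \<and> \<phi> ` A \<subseteq> B \<and> (\<forall>x\<in>A. \<delta>' (\<phi> x) = tensor_map A A \<phi> \<phi> (\<delta> x))"

definition lie_coalgebra_iso ::
    "'b set \<Rightarrow> ('b \<Rightarrow> ('a, 'b) tensor2) \<Rightarrow> 'b set \<Rightarrow> ('b \<Rightarrow> ('a, 'b) tensor2) \<Rightarrow> ('b \<Rightarrow> 'b) \<Rightarrow> bool" where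
  "lie_coalgebra_iso A \<delta> B \<delta>' \<phi> \<longleftrightarrow> lie_coalgebra_hom A \<delta> B \<delta>' \<phi> \<and> bij_betw \<phi> A B"

definition lie_subcoalgebra ::
    "'b set \<Rightarrow> ('b \<Rightarrow> ('a, 'b) tensor2) \<Rightarrow> 'b set \<Rightarrow> ('b \<Rightarrow> ('a, 'b) tensor2) \<Rightarrow> bool" where
  "lie_subcoalgebra A \<delta> B \<delta>' \<longleftrightarrow>
     lie_coalgebra A \<delta> \<and> lie_coalgebra B \<delta>' \<and> A \<subseteq> B \<and> (\<forall>x\<in>A. \<delta>' x = \<delta> x)"


subsection \<open>Extensions of \<open>(g, \<delta>g)\<close> to the ambient space \<open>E = UNIV\<close>\<close>

definition extensions :: "'b set \<Rightarrow> ('b \<Rightarrow> ('a, 'b) tensor2) \<Rightarrow> ('b \<Rightarrow> ('a, 'b) tensor2) set" where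
  "extensions g \<delta>g = {\<delta>E. lie_coalgebra UNIV \<delta>E \<and> lie_subcoalgebra g \<delta>g UNIV \<delta>E}"

definition ext_equiv ::
    "'b set \<Rightarrow> ('b \<Rightarrow> ('a, 'b) tensor2) \<Rightarrow> (('b \<Rightarrow> ('a, 'b) tensor2) \<times> ('b \<Rightarrow> ('a, 'b) tensor2)) set" where
  "ext_equiv g \<delta>g = {(\<delta>E, \<delta>E'). \<delta>E \<in> extensions g \<delta>g \<and> \<delta>E' \<in> extensions g \<delta>g \<and>
     (\<exists>\<phi>. lie_coalgebra_iso UNIV \<delta>E UNIV \<delta>E' \<phi> \<and> (\<forall>x\<in>g. \<phi> x = x))}"

definition CExtd :: "'b set \<Rightarrow> ('b \<Rightarrow> ('a, 'b) tensor2) \<Rightarrow> ('b \<Rightarrow> ('a, 'b) tensor2) set set" where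
  "CExtd g \<delta>g = extensions g \<delta>g // ext_equiv g \<delta>g"


subsection \<open>Extending structures\<close>

definition extending_datum :: "'b set \<Rightarrow> 'b set \<Rightarrow> ('a, 'b) datum \<Rightarrow> bool" where
  "extending_datum g V = (\<lambda>(\<Delta>E, \<Delta>V, \<delta>V).
     \<Delta>E \<in> lin_maps scale2 V (tensor_space g V) \<and>
     \<Delta>V \<in> lin_maps scale2 V (tensor_space g g) \<and>
     \<delta>V \<in> lin_maps scale2 V (tensor_space V V))"

text \<open>The following makes sense when every element is \<open>a + x\<close> for unique \<open>a \<in> g\<close>, \<open>x \<in> V\<close>.\<close>

definition unified_coproduct ::
    "'b set \<Rightarrow> ('b \<Rightarrow> ('a, 'b) tensor2) \<Rightarrow> 'b set \<Rightarrow> ('a, 'b) datum \<Rightarrow> 'b \<Rightarrow> ('a, 'b) tensor2" where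
  "unified_coproduct g \<delta>g V = (\<lambda>(\<Delta>E, \<Delta>V, \<delta>V) e.
     THE t. \<exists>a\<in>g. \<exists>x\<in>V. e = a + x \<and> t = \<delta>g a + \<Delta>E x - swap (\<Delta>E x) + \<Delta>V x + \<delta>V x)"

definition LC :: "'b set \<Rightarrow> ('b \<Rightarrow> ('a, 'b) tensor2) \<Rightarrow> 'b set \<Rightarrow> ('a, 'b) datum set" where
  "LC g \<delta>g V =
     {\<Omega>. extending_datum g V \<Omega> \<and> lie_coalgebra UNIV (unified_coproduct g \<delta>g V \<Omega>)}"

definition LC_equiv ::
    "'b set \<Rightarrow> ('b \<Rightarrow> ('a, 'b) tensor2) \<Rightarrow> 'b set \<Rightarrow> (('a, 'b) datum \<times> ('a, 'b) datum) set" where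
  "LC_equiv g \<delta>g V = {((\<Delta>E, \<Delta>V, \<delta>V), (\<Delta>E', \<Delta>V', \<delta>V')) | \<Delta>E \<Delta>V \<delta>V \<Delta>E' \<Delta>V' \<delta>V'.
     (\<Delta>E, \<Delta>V, \<delta>V) \<in> LC g \<delta>g V \<and> (\<Delta>E', \<Delta>V', \<delta>V') \<in> LC g \<delta>g V \<and>
     (\<exists>p \<in> lin_maps scale V g. \<exists>q \<in> lin_maps scale V V. bij_betw q V V \<and>
       (\<forall>x\<in>V. let y = inv_into V q x in
         \<delta>V' x = tensor_map V V q q (\<delta>V y) \<and>
         \<Delta>E' x = tensor_map g V id q (\<Delta>E y) + tensor_map V V p q (\<delta>V y) \<and>
         \<Delta>V' x = tensor_map g V id p (\<Delta>E y) - tensor_map V g p id (swap (\<Delta>E y))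
                  + tensor_map V V p p (\<delta>V y) + \<Delta>V y - \<delta>g (p y)))}"

definition HC2 :: "'b set \<Rightarrow> ('b \<Rightarrow> ('a, 'b) tensor2) \<Rightarrow> 'b set \<Rightarrow> ('a, 'b) datum set set" where
  "HC2 g \<delta>g V = LC g \<delta>g V // LC_equiv g \<delta>g V"

end

end

theory Submission
  imports Defs
begin

text \<open>
  The unified co-product maps the extending structures onto all extensions of
  \<open>(g, \<delta>g)\<close>: split \<open>\<delta>E x\<close> for \<open>x \<in> V\<close> along \<open>E = g \<oplus> V\<close>; antisymmetry of \<open>\<delta>E\<close> determines the
  \<open>V \<otimes> g\<close> component from the \<open>g \<otimes> V\<close> one. A linear map fixing \<open>g\<close> has the form
  \<open>a + x \<mapsto> a + p x + q x\<close>, it is bijective iff \<open>q\<close> is, and the components (three, by antisymmetry) of the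
  homomorphism equation on \<open>V\<close> are the formulas that define equivalence of extending structures.
  So that relation is the pullback of equivalence of extensions. The co-Jacobi identity is
  carried along and never expanded.
\<close>

section \<open>Quotients by a pulled-back equivalence relation\<close>

lemma pullback_equiv:
  assumes R: "equiv B R" and f: "f ` A = B"
    and S: "\<And>x y. (x, y) \<in> S \<longleftrightarrow> x \<in> A \<and> y \<in> A \<and> (f x, f y) \<in> R"
  shows "equiv A S"
proof (rule equivI)
  show "S \<subseteq> A \<times> A" using S by auto
  show "refl_on A S"
    using S f R unfolding equiv_def refl_on_def by blast
  show "sym S"
    using S R unfolding equiv_def sym_def by blast
  show "trans S"
    using S R unfolding equiv_def trans_def by blast
qed

text \<open>That \<open>S\<close> is exactly the pullback of \<open>R\<close> makes the map on
  classes both well defined and injective; surjectivity comes from that of \<open>f\<close>.\<close>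

lemma pullback_quotient_bij:
  assumes R: "equiv B R" and f: "f ` A = B"
    and S: "\<And>x y. (x, y) \<in> S \<longleftrightarrow> x \<in> A \<and> y \<in> A \<and> (f x, f y) \<in> R"
  shows "\<exists>F. (\<forall>x\<in>A. F (S `` {x}) = R `` {f x}) \<and> bij_betw F (A // S) (B // R)"
proof (intro exI conjI ballI)
  \<comment> \<open>Taking all elements related to the image of some member of \<open>C\<close>
    avoids choosing a representative.\<close>
  let ?F = "\<lambda>C. R `` (f ` C)"
  show F: "?F (S `` {x}) = R `` {f x}" if x: "x \<in> A" for x
  proof (intro equalityI subsetI)
    fix z assume "z \<in> ?F (S `` {x})"
    then show "z \<in> R `` {f x}" using S R unfolding equiv_def trans_def by blast
  next
    fix z assume z: "z \<in> R `` {f x}"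
    have "x \<in> S `` {x}" using equiv_class_self[OF pullback_equiv[OF R f S]] x by blast
    then show "z \<in> ?F (S `` {x})" using z by blast
  qed
  show "bij_betw ?F (A // S) (B // R)"
  proof (rule bij_betwI')
    fix X Y assume "X \<in> A // S" "Y \<in> A // S"
    then obtain x y where xy: "x \<in> A" "X = S `` {x}" "y \<in> A" "Y = S `` {y}"
      by (auto elim!: quotientE)
    have "f x \<in> B" "f y \<in> B" using xy f by auto
    then have "R `` {f x} = R `` {f y} \<longleftrightarrow> (f x, f y) \<in> R"
      using eq_equiv_class_iff[OF R] by blast
    also have "\<dots> \<longleftrightarrow> S `` {x} = S `` {y}"
      using eq_equiv_class_iff[OF pullback_equiv[OF R f S]] xy S by blast
    finally show "?F X = ?F Y \<longleftrightarrow> X = Y" using F xy by simp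
  next
    fix X assume "X \<in> A // S"
    then obtain x where "x \<in> A" "X = S `` {x}" by (auto elim!: quotientE)
    then show "?F X \<in> B // R" using F f by (auto intro: quotientI)
  next
    fix Y assume "Y \<in> B // R"
    then obtain x where x: "x \<in> A" "Y = R `` {f x}" using f by (auto elim!: quotientE)
    then show "\<exists>X\<in>A // S. Y = ?F X"
      using F by (intro bexI[of _ "S `` {x}"]) (auto intro: quotientI)
  qed
qed

section \<open>The flip and induction on tensors\<close>

lemma swap_add: "swap (t + u) = swap t + swap u"
  and swap_minus: "swap (- t) = - swap (t :: ('k::ab_group_add, 'e) tensor2)"
  and swap_diff: "swap (t - u) = swap t - swap (u :: ('k::ab_group_add, 'e) tensor2)"
  and swap_0: "swap (0 :: ('k::ab_group_add, 'e) tensor2) = 0"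
  and swap_swap: "swap (swap t) = t"
  by (simp_all add: swap_def fun_eq_iff)

lemmas swap_simps = swap_add swap_minus swap_diff swap_0 swap_swap

text \<open>Tensors are functions; evaluating their sums pointwise would hide them from the rules below.\<close>

declare plus_fun_apply [simp del] zero_fun_apply [simp del]

context vector_space
begin

text \<open>Tensors are finite sums of pure tensors without coefficients, so additive statements
  only have to be checked on pure tensors and no case for scalar multiples arises.\<close>

lemma tensor_space_induct [consumes 1, case_names zero add]:
  assumes t: "t \<in> tensor_space A B" and 0: "P 0"
    and add: "\<And>a b t. a \<in> A \<Longrightarrow> b \<in> B \<Longrightarrow> t \<in> tensor_space A B \<Longrightarrow> P t \<Longrightarrow> P (a \<otimes> b + t)"
  shows "P t"
proof -
  obtain xs where xs: "set xs \<subseteq> A \<times> B" "t = (\<Sum>(a, b)\<leftarrow>xs. a \<otimes> b)"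
    using t by (auto simp: tensor_space_def)
  have "P (\<Sum>(a, b)\<leftarrow>xs. a \<otimes> b)" using xs(1)
  proof (induction xs)
    case (Cons x xs)
    moreover have "(\<Sum>(a, b)\<leftarrow>xs. a \<otimes> b) \<in> tensor_space A B"
      using Cons.prems by (auto simp: tensor_space_def)
    ultimately show ?case using add by (cases x) auto
  qed (simp add: 0)
  then show ?thesis using xs by simp
qed

lemma zero_in_tensor_space: "0 \<in> tensor_space A B"
  unfolding tensor_space_def by (rule CollectI, rule exI[of _ "[]"]) simp

lemma swap_in_tensor_space: "t \<in> tensor_space A B \<Longrightarrow> swap t \<in> tensor_space B A"
  by (induction rule: tensor_space_induct)
    (auto simp: swap_simps swap_tensor zero_in_tensor_space
      intro!: tensor_space_add tensor_in_tensor_space)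

subsection \<open>Pushforward of tensors\<close>

text \<open>This is \<phi> \<otimes> \<psi> in the model of tensors as forms on functionals:
  precomposition with the transposes of \<phi> and \<psi>. No decomposition into pure tensors is
  chosen, so additivity is immediate. The guard is there because \<open>f \<circ> \<phi>\<close> can
  be linear although \<open>f\<close> is not, whereas \<open>ev\<close> vanishes outside
  \<open>dual\<close>.\<close>

definition push :: "('b \<Rightarrow> 'b) \<Rightarrow> ('b \<Rightarrow> 'b) \<Rightarrow> ('a, 'b) tensor2 \<Rightarrow> ('a, 'b) tensor2" where
  "push \<phi> \<psi> t = (\<lambda>f h. if f \<in> dual \<and> h \<in> dual then t (f \<circ> \<phi>) (h \<circ> \<psi>) else 0)"

lemma push_add: "push \<phi> \<psi> (t + u) = push \<phi> \<psi> t + push \<phi> \<psi> u"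
  and push_minus: "push \<phi> \<psi> (- t) = - push \<phi> \<psi> t"
  and push_diff: "push \<phi> \<psi> (t - u) = push \<phi> \<psi> t - push \<phi> \<psi> u"
  and push_zero: "push \<phi> \<psi> 0 = 0"
  and push_swap: "push \<phi> \<psi> (swap t) = swap (push \<psi> \<phi> t)"
  and push_scale2: "push \<phi> \<psi> (scale2 c t) = scale2 c (push \<phi> \<psi> t)"
  by (auto simp: push_def swap_def scale2_def plus_fun_apply zero_fun_apply fun_eq_iff)

lemmas push_simps = push_add push_minus push_diff push_zero push_swap

lemma dual_comp: "f \<in> dual \<Longrightarrow> linear_on UNIV scale \<phi> \<Longrightarrow> f \<circ> \<phi> \<in> dual"
  by (simp add: dual_def linear_on_def Vector_Spaces.linear_iff)

lemma push_tensor: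
  "linear_on UNIV scale \<phi> \<Longrightarrow> linear_on UNIV scale \<psi> \<Longrightarrow> push \<phi> \<psi> (x \<otimes> y) = \<phi> x \<otimes> \<psi> y"
  by (auto simp: push_def tensor_def ev_def dual_comp fun_eq_iff)

text \<open>Linearity of the outer maps keeps the precomposed functionals in \<open>dual\<close>, so
  that the guard of the inner \<open>push\<close> is passed.\<close>

lemma push_comp:
  "linear_on UNIV scale \<phi> \<Longrightarrow> linear_on UNIV scale \<psi> \<Longrightarrow>
    push \<phi> \<psi> (push \<phi>' \<psi>' t) = push (\<phi> \<circ> \<phi>') (\<psi> \<circ> \<psi>') t"
  by (auto simp: push_def dual_comp comp_assoc fun_eq_iff)

lemma tensor_add_left: "(x + y) \<otimes> z = x \<otimes> z + y \<otimes> z"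
  and tensor_add_right: "x \<otimes> (y + z) = x \<otimes> y + x \<otimes> z"
  and tensor_zero_left: "0 \<otimes> z = 0"
  and tensor_zero_right: "z \<otimes> 0 = 0"
  using ev_scale[of 0 0]
  by (simp_all add: tensor_def ev_add plus_fun_apply zero_fun_apply algebra_simps fun_eq_iff)

lemma push_in_tensor_space:
  assumes "t \<in> tensor_space A B" "linear_on UNIV scale \<phi>" "linear_on UNIV scale \<psi>"
    "\<And>a. a \<in> A \<Longrightarrow> \<phi> a \<in> C" "\<And>b. b \<in> B \<Longrightarrow> \<psi> b \<in> D"
  shows "push \<phi> \<psi> t \<in> tensor_space C D"
  using assms(1)
  by (induction rule: tensor_space_induct)
    (auto simp: push_simps push_tensor assms zero_in_tensor_space
      intro!: tensor_space_add tensor_in_tensor_space)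

lemma push_id_on:
  assumes "t \<in> tensor_space A B" "linear_on UNIV scale \<phi>" "linear_on UNIV scale \<psi>"
    "\<And>a. a \<in> A \<Longrightarrow> \<phi> a = a" "\<And>b. b \<in> B \<Longrightarrow> \<psi> b = b"
  shows "push \<phi> \<psi> t = t"
  using assms(1)
  by (induction rule: tensor_space_induct) (simp_all add: push_simps push_tensor assms)

lemma push_zero_on:
  assumes "t \<in> tensor_space A B" "linear_on UNIV scale \<phi>" "linear_on UNIV scale \<psi>"
    "(\<forall>a\<in>A. \<phi> a = 0) \<or> (\<forall>b\<in>B. \<psi> b = 0)"
  shows "push \<phi> \<psi> t = 0"
  using assms(1)
proof (induction rule: tensor_space_induct)
  case (add a b t)
  then have "\<phi> a \<otimes> \<psi> b = 0" using assms(4) by (auto simp: tensor_zero_left tensor_zero_right)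
  then show ?case using add assms by (simp add: push_simps push_tensor)
qed (simp add: push_simps)

lemma push_sum_left:
  assumes "t \<in> tensor_space A B" "linear_on UNIV scale \<phi>" "linear_on UNIV scale \<phi>'"
    "linear_on UNIV scale \<psi>" "linear_on UNIV scale \<theta>"
    "\<And>a. a \<in> A \<Longrightarrow> \<theta> a = \<phi> a + \<phi>' a"
  shows "push \<theta> \<psi> t = push \<phi> \<psi> t + push \<phi>' \<psi> t"
  using assms(1)
  by (induction rule: tensor_space_induct)
    (simp_all add: push_simps push_tensor assms tensor_add_left algebra_simps)

lemma push_sum_right:
  assumes "t \<in> tensor_space A B" "linear_on UNIV scale \<phi>" "linear_on UNIV scale \<phi>'"
    "linear_on UNIV scale \<psi>" "linear_on UNIV scale \<theta>"
    "\<And>b. b \<in> B \<Longrightarrow> \<theta> b = \<phi> b + \<phi>' b"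
  shows "push \<psi> \<theta> t = push \<psi> \<phi> t + push \<psi> \<phi>' t"
  using assms(1)
  by (induction rule: tensor_space_induct)
    (simp_all add: push_simps push_tensor assms tensor_add_right algebra_simps)

text \<open>Both sides are linear and agree on pure tensors, so the universal property identifies
  them. The maps \<phi>' and \<psi>' matter only on \<open>A\<close> and \<open>B\<close>; this lets
  maps defined on \<open>V\<close> alone be replaced by linear maps on the whole space.\<close>

lemma tensor_map_eq_push:
  assumes A: "subspace A" and B: "subspace B" and t: "t \<in> tensor_space A B"
    and \<phi>: "linear_on UNIV scale \<phi>" and \<psi>: "linear_on UNIV scale \<psi>"
    and eq: "\<And>a. a \<in> A \<Longrightarrow> \<phi>' a = \<phi> a" "\<And>b. b \<in> B \<Longrightarrow> \<psi>' b = \<psi> b"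
  shows "tensor_map A B \<phi>' \<psi>' t = push \<phi> \<psi> t"
proof -
  interpret T: vector_space "scale2 :: 'a \<Rightarrow> ('a, 'b) tensor2 \<Rightarrow> _" by (rule vector_space_scale2)
  have "bilinear_on A B scale2 (\<lambda>a b. \<phi>' a \<otimes> \<psi>' b)"
    using \<phi> \<psi> eq subspace_add[OF A] subspace_add[OF B] subspace_scale[OF A] subspace_scale[OF B]
    by (auto simp: bilinear_on_def linear_on_def tensor_def ev_add ev_scale scale2_def
      plus_fun_apply fun_eq_iff algebra_simps)
  then show ?thesis
    unfolding tensor_map_def
    by (intro tlift_unique[OF A B vector_space_scale2, symmetric] t)
      (auto simp: T.linear_on_def push_add push_scale2 push_tensor \<phi> \<psi> eq)
qed

lemma linear_on_comp:
  "linear_on UNIV scale \<phi> \<Longrightarrow> linear_on UNIV scale \<psi> \<Longrightarrow> linear_on UNIV scale (\<phi> \<circ> \<psi>)"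
  by (simp add: linear_on_def)

lemma linear_on_id: "linear_on A scale id"
  by (simp add: linear_on_def)

subsection \<open>Equivalence of extensions\<close>

lemma extensions_tensor_space: "\<delta> \<in> extensions g \<delta>g \<Longrightarrow> \<delta> x \<in> tensor_space UNIV UNIV"
  by (auto simp: extensions_def lie_coalgebra_def)

text \<open>Values of an extension lie in E \<otimes> E, where \<open>tensor_map\<close> agrees with
  \<open>push\<close>; the composition rule for \<open>push\<close> then handles inverses and
  composites of isomorphisms.\<close>

lemma ext_equiv_iff:
  "(\<delta>, \<delta>') \<in> ext_equiv g \<delta>g \<longleftrightarrow> \<delta> \<in> extensions g \<delta>g \<and> \<delta>' \<in> extensions g \<delta>g \<and>
    (\<exists>\<phi>. linear_on UNIV scale \<phi> \<and> bij \<phi> \<and> (\<forall>x\<in>g. \<phi> x = x) \<and> (\<forall>x. \<delta>' (\<phi> x) = push \<phi> \<phi> (\<delta> x)))"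
proof -
  have "tensor_map UNIV UNIV \<phi> \<phi> (\<delta> x) = push \<phi> \<phi> (\<delta> x)"
    if "linear_on UNIV scale \<phi>" "\<delta> \<in> extensions g \<delta>g" for \<phi> x
    using that by (intro tensor_map_eq_push subspace_UNIV extensions_tensor_space) auto
  then show ?thesis
    by (auto simp: ext_equiv_def lie_coalgebra_iso_def lie_coalgebra_hom_def)
qed

lemma equiv_ext_equiv: "equiv (extensions g \<delta>g) (ext_equiv g \<delta>g)"
proof (rule equivI)
  show "ext_equiv g \<delta>g \<subseteq> extensions g \<delta>g \<times> extensions g \<delta>g"
    by (auto simp: ext_equiv_def)
  have "(\<delta>, \<delta>) \<in> ext_equiv g \<delta>g" if "\<delta> \<in> extensions g \<delta>g" for \<delta>
    using that push_id_on[OF extensions_tensor_space[OF that] linear_on_id linear_on_id]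
    by (auto simp: ext_equiv_iff linear_on_id intro!: exI[of _ id])
  then show "refl_on (extensions g \<delta>g) (ext_equiv g \<delta>g)"
    by (auto simp: refl_on_def)
  show "sym (ext_equiv g \<delta>g)"
  proof (rule symI)
    fix \<delta> \<delta>' assume a: "(\<delta>, \<delta>') \<in> ext_equiv g \<delta>g"
    then obtain \<phi> where e: "\<delta> \<in> extensions g \<delta>g" "\<delta>' \<in> extensions g \<delta>g"
      and \<phi>: "linear_on UNIV scale \<phi>" "bij \<phi>" "\<forall>x\<in>g. \<phi> x = x"
      and h: "\<And>x. \<delta>' (\<phi> x) = push \<phi> \<phi> (\<delta> x)"
      by (auto simp: ext_equiv_iff)
    let ?i = "inv \<phi>"
    have inv: "\<phi> (?i x) = x" "?i (\<phi> x) = x" for x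
      using \<phi>(2) by (auto simp: bij_def surj_f_inv_f)
    have "?i (x + y) = ?i x + ?i y" "?i (scale c x) = scale c (?i x)" for x y c
      using \<phi>(1) inv unfolding linear_on_def by (metis UNIV_I)+
    then have li: "linear_on UNIV scale ?i" by (simp add: linear_on_def)
    have "\<delta> (?i x) = push ?i ?i (\<delta>' x)" for x
    proof -
      \<comment> \<open>The homomorphism equation at \<open>?i x\<close> is pushed forward along
        \<open>?i\<close>, which cancels \<phi>.\<close>
      have "push ?i ?i (\<delta>' x) = push (?i \<circ> \<phi>) (?i \<circ> \<phi>) (\<delta> (?i x))"
        using h[of "?i x"] inv push_comp[OF li li] by simp
      also have "\<dots> = \<delta> (?i x)"
        by (rule push_id_on[OF extensions_tensor_space[OF e(1)]])
          (simp_all add: linear_on_comp li \<phi> inv)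
      finally show ?thesis by simp
    qed
    moreover have "\<forall>x\<in>g. ?i x = x" using inv \<phi>(3) by metis
    ultimately show "(\<delta>', \<delta>) \<in> ext_equiv g \<delta>g"
      using e li bij_imp_bij_inv[OF \<phi>(2)] by (auto simp: ext_equiv_iff)
  qed
  show "trans (ext_equiv g \<delta>g)"
  proof (rule transI)
    fix \<delta> \<delta>' \<delta>'' assume a: "(\<delta>, \<delta>') \<in> ext_equiv g \<delta>g" "(\<delta>', \<delta>'') \<in> ext_equiv g \<delta>g"
    obtain \<phi> where \<phi>: "linear_on UNIV scale \<phi>" "bij \<phi>" "\<forall>x\<in>g. \<phi> x = x"
      "\<And>x. \<delta>' (\<phi> x) = push \<phi> \<phi> (\<delta> x)"
      using a(1) by (auto simp: ext_equiv_iff)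
    obtain \<psi> where \<psi>: "linear_on UNIV scale \<psi>" "bij \<psi>" "\<forall>x\<in>g. \<psi> x = x"
      "\<And>x. \<delta>'' (\<psi> x) = push \<psi> \<psi> (\<delta>' x)"
      using a(2) by (auto simp: ext_equiv_iff)
    show "(\<delta>, \<delta>'') \<in> ext_equiv g \<delta>g"
      using a \<phi> \<psi> linear_on_comp[OF \<psi>(1) \<phi>(1)] bij_comp[OF \<phi>(2) \<psi>(2)] push_comp[OF \<psi>(1) \<psi>(1)]
      by (auto simp: ext_equiv_iff intro!: exI[of _ "\<psi> \<circ> \<phi>"])
  qed
qed

end

subsection \<open>Extending structures\<close>

locale lie_coalgebra_complement = vector_space scale
  for scale :: "'k::field \<Rightarrow> 'e::ab_group_add \<Rightarrow> 'e" +
  fixes g V :: "'e set" and \<delta>g :: "'e \<Rightarrow> ('k, 'e) tensor2"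
  assumes coalgebra: "lie_coalgebra g \<delta>g"
    and V: "subspace V"
    and g_Int_V: "g \<inter> V = {0}"
    and g_plus_V: "{a + x | a x. a \<in> g \<and> x \<in> V} = UNIV"
begin

lemma g: "subspace g"
  using coalgebra by (simp add: lie_coalgebra_def)

lemma \<delta>g_in: "a \<in> g \<Longrightarrow> \<delta>g a \<in> tensor_space g g"
  using coalgebra by (auto simp: lie_coalgebra_def)

lemma \<delta>g_0: "\<delta>g 0 = 0"
  using coalgebra linear_on_sum_list[OF g vector_space_scale2, of \<delta>g "[]"]
  by (simp add: lie_coalgebra_def)

section \<open>The projections onto the two summands and the resulting blocks of a tensor\<close>

definition pg :: "'e \<Rightarrow> 'e" where
  "pg e = (THE a. a \<in> g \<and> e - a \<in> V)"

definition pV :: "'e \<Rightarrow> 'e" where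
  "pV e = e - pg e"

lemma pg_sum: assumes "a \<in> g" "x \<in> V" shows "pg (a + x) = a"
  unfolding pg_def
proof (rule the_equality)
  fix b assume b: "b \<in> g \<and> a + x - b \<in> V"
  have "a - b \<in> g" using b assms subspace_diff[OF g] by blast
  moreover have "a - b \<in> V" using subspace_diff[OF V, of "a + x - b" x] b assms by simp
  ultimately have "a - b = 0" using g_Int_V by blast
  then show "b = a" by simp
qed (use assms in simp)

lemma pV_sum: "a \<in> g \<Longrightarrow> x \<in> V \<Longrightarrow> pV (a + x) = x"
  by (simp add: pV_def pg_sum)

lemma complement_cases:
  obtains a x where "a \<in> g" "x \<in> V" "e = a + x"
  using g_plus_V by blast

lemma pg_in: "pg e \<in> g" and pV_in: "pV e \<in> V" and pg_add_pV: "pg e + pV e = e"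
proof -
  obtain a x where "a \<in> g" "x \<in> V" "e = a + x" by (rule complement_cases)
  then show "pg e \<in> g" "pV e \<in> V" by (simp_all add: pg_sum pV_sum)
qed (simp add: pV_def)

lemma pg_g: "a \<in> g \<Longrightarrow> pg a = a" and pV_g: "a \<in> g \<Longrightarrow> pV a = 0"
  using pg_sum[of a 0] pV_sum[of a 0] subspace_0[OF V] by simp_all

lemma pg_V: "x \<in> V \<Longrightarrow> pg x = 0" and pV_V: "x \<in> V \<Longrightarrow> pV x = x"
  using pg_sum[of 0 x] pV_sum[of 0 x] subspace_0[OF g] by simp_all

lemma linear_pg: "linear_on UNIV scale pg"
proof -
  have "pg (e + e') = pg e + pg e'" for e e'
    using pg_sum[of "pg e + pg e'" "pV e + pV e'"]
      subspace_add[OF g] subspace_add[OF V] pg_in pV_in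
    by (simp add: pV_def)
  moreover have "pg (scale c e) = scale c (pg e)" for c e
    using pg_sum[of "scale c (pg e)" "scale c (pV e)"]
      subspace_scale[OF g] subspace_scale[OF V] pg_in pV_in
    by (simp add: scale_right_distrib[symmetric] pg_add_pV)
  ultimately show ?thesis by (simp add: linear_on_def)
qed

lemma linear_pV: "linear_on UNIV scale pV"
  using linear_pg by (simp add: linear_on_def pV_def algebra_simps)

text \<open>Extends a linear map given on \<open>V\<close> by zero on \<open>g\<close>.\<close>

lemma linear_on_comp_pV: "linear_on V scale p \<Longrightarrow> linear_on UNIV scale (p \<circ> pV)"
  using linear_pV pV_in by (auto simp: linear_on_def)

text \<open>Expanding id \<otimes> id with id = \<open>pg\<close> + \<open>pV\<close> in both
  factors gives the four blocks of E \<otimes> E.\<close>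

lemma push_decomp:
  assumes t: "t \<in> tensor_space UNIV UNIV"
  shows "push pg pg t + push pg pV t + (push pV pg t + push pV pV t) = t"
proof -
  have "push pg pg t + push pg pV t = push pg id t"
    by (rule push_sum_right[OF t, symmetric])
      (simp_all add: linear_pg linear_pV linear_on_id pg_add_pV)
  moreover have "push pV pg t + push pV pV t = push pV id t"
    by (rule push_sum_right[OF t, symmetric])
      (simp_all add: linear_pg linear_pV linear_on_id pg_add_pV)
  moreover have "push pg id t + push pV id t = push id id t"
    by (rule push_sum_left[OF t, symmetric])
      (simp_all add: linear_pg linear_pV linear_on_id pg_add_pV)
  moreover have "push id id t = t" by (rule push_id_on[OF t]) (simp_all add: linear_on_id)
  ultimately show ?thesis by simp
qed

text \<open>Antisymmetry makes the V \<otimes> g block minus the flip of the g \<otimes> V block.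
  Hence three blocks determine the tensor, and the sum has the shape of the unified
  co-product.\<close>

lemma push_decomp_antisym:
  assumes "t \<in> tensor_space UNIV UNIV" "t = - swap t"
  shows "push pg pg t + push pg pV t - swap (push pg pV t) + push pV pV t = t"
proof -
  have "push pV pg t = - swap (push pg pV t)"
    by (subst assms(2)) (simp add: push_simps)
  then show ?thesis using push_decomp[OF assms(1)] by (simp add: algebra_simps)
qed

section \<open>The unified co-product and its blocks\<close>

abbreviation U :: "('k, 'e) datum \<Rightarrow> 'e \<Rightarrow> ('k, 'e) tensor2" where
  "U \<equiv> unified_coproduct g \<delta>g V"

lemma U_sum:
  assumes "a \<in> g" "x \<in> V"
  shows "U (\<Delta>E, \<Delta>V, \<delta>V) (a + x) = \<delta>g a + \<Delta>E x - swap (\<Delta>E x) + \<Delta>V x + \<delta>V x"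
  unfolding unified_coproduct_def prod.case
proof (rule the_equality)
  fix t assume "\<exists>b\<in>g. \<exists>y\<in>V. a + x = b + y \<and>
    t = \<delta>g b + \<Delta>E y - swap (\<Delta>E y) + \<Delta>V y + \<delta>V y"
  then obtain b y where bt: "b \<in> g" "y \<in> V" "a + x = b + y"
    "t = \<delta>g b + \<Delta>E y - swap (\<Delta>E y) + \<Delta>V y + \<delta>V y"
    by blast
  have "b = a" "y = x" using bt(3) pg_sum pV_sum assms bt(1,2) by metis+
  then show "t = \<delta>g a + \<Delta>E x - swap (\<Delta>E x) + \<Delta>V x + \<delta>V x" using bt(4) by simp
qed (use assms in blast)

context
  fixes \<Delta>E \<Delta>V \<delta>V
  assumes datum: "extending_datum g V (\<Delta>E, \<Delta>V, \<delta>V)"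
begin

lemma \<Delta>E_in: "x \<in> V \<Longrightarrow> \<Delta>E x \<in> tensor_space g V"
  and \<Delta>V_in: "x \<in> V \<Longrightarrow> \<Delta>V x \<in> tensor_space g g"
  and \<delta>V_in: "x \<in> V \<Longrightarrow> \<delta>V x \<in> tensor_space V V"
  using datum by (auto simp: extending_datum_def lin_maps_def)

lemma datum_0: "\<Delta>E 0 = 0" "\<Delta>V 0 = 0" "\<delta>V 0 = 0"
  using datum linear_on_sum_list[OF V vector_space_scale2, of \<Delta>E "[]"]
    linear_on_sum_list[OF V vector_space_scale2, of \<Delta>V "[]"]
    linear_on_sum_list[OF V vector_space_scale2, of \<delta>V "[]"]
  by (simp_all add: extending_datum_def lin_maps_def)

lemma U_g: "a \<in> g \<Longrightarrow> U (\<Delta>E, \<Delta>V, \<delta>V) a = \<delta>g a"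
  using U_sum[of a 0] subspace_0[OF V] by (simp add: datum_0 swap_0)

lemma U_V: "x \<in> V \<Longrightarrow> U (\<Delta>E, \<Delta>V, \<delta>V) x = \<Delta>E x - swap (\<Delta>E x) + \<Delta>V x + \<delta>V x"
  using U_sum[of 0 x] subspace_0[OF g] by (simp add: \<delta>g_0)

text \<open>Each summand of the co-product lies in a single block and is fixed or killed by each
  pair of projections. Only g \<otimes> g receives two contributions, which is the source of the
  term \<delta>g (p y) in the equivalence of extending structures.\<close>

lemma U_components:
  assumes a: "a \<in> g" and x: "x \<in> V"
  shows "push pV pV (U (\<Delta>E, \<Delta>V, \<delta>V) (a + x)) = \<delta>V x"
    and "push pg pV (U (\<Delta>E, \<Delta>V, \<delta>V) (a + x)) = \<Delta>E x"
    and "push pg pg (U (\<Delta>E, \<Delta>V, \<delta>V) (a + x)) = \<delta>g a + \<Delta>V x"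
  using push_zero_on[OF \<delta>g_in[OF a]] push_id_on[OF \<delta>g_in[OF a]]
    push_zero_on[OF \<Delta>E_in[OF x]] push_id_on[OF \<Delta>E_in[OF x]]
    push_zero_on[OF \<Delta>V_in[OF x]] push_id_on[OF \<Delta>V_in[OF x]]
    push_zero_on[OF \<delta>V_in[OF x]] push_id_on[OF \<delta>V_in[OF x]]
  by (simp_all add: U_sum[OF a x] push_simps swap_0 linear_pg linear_pV pg_g pV_g pg_V pV_V)

text \<open>The composite of \<open>pg\<close> with \<phi> is the identity on \<open>g\<close> and
  \<open>p\<close> on \<open>V\<close>; the composite of \<open>pV\<close> with \<phi> is zero on
  \<open>g\<close> and \<open>q\<close> on \<open>V\<close>. Applying these to each summand yields
  the right-hand sides of the equivalence formulas, up to the term \<delta>g (p y).\<close>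

lemma push_U_components:
  assumes \<phi>: "linear_on UNIV scale \<phi>" and on_g: "\<And>a. a \<in> g \<Longrightarrow> \<phi> a = a"
    and pq: "\<And>x. x \<in> V \<Longrightarrow> p x \<in> g \<and> q x \<in> V \<and> \<phi> x = p x + q x" and y: "y \<in> V"
  defines "t \<equiv> push \<phi> \<phi> (U (\<Delta>E, \<Delta>V, \<delta>V) y)"
  shows "push pV pV t = tensor_map V V q q (\<delta>V y)"
    and "push pg pV t = tensor_map g V id q (\<Delta>E y) + tensor_map V V p q (\<delta>V y)"
    and "push pg pg t = tensor_map g V id p (\<Delta>E y) - tensor_map V g p id (swap (\<Delta>E y))
      + tensor_map V V p p (\<delta>V y) + \<Delta>V y"
proof -
  let ?g = "pg \<circ> \<phi>" and ?V = "pV \<circ> \<phi>"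
  note lin = linear_on_comp[OF linear_pg \<phi>] linear_on_comp[OF linear_pV \<phi>]
  have g_on: "?g a = a" "?V a = 0" if "a \<in> g" for a using that on_g pg_g pV_g by simp_all
  have V_on: "?g x = p x" "?V x = q x" if "x \<in> V" for x
    using pq[OF that] pg_sum pV_sum by simp_all
  note \<Delta>E = \<Delta>E_in[OF y] and sE = swap_in_tensor_space[OF \<Delta>E_in[OF y]]
    and \<Delta>V = \<Delta>V_in[OF y] and \<delta>V = \<delta>V_in[OF y]
  have m: "tensor_map g V id p (\<Delta>E y) = push ?g ?g (\<Delta>E y)"
    "tensor_map g V id q (\<Delta>E y) = push ?g ?V (\<Delta>E y)"
    "tensor_map V g p id (swap (\<Delta>E y)) = push ?g ?g (swap (\<Delta>E y))"
    "tensor_map V V p p (\<delta>V y) = push ?g ?g (\<delta>V y)"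
    "tensor_map V V p q (\<delta>V y) = push ?g ?V (\<delta>V y)"
    "tensor_map V V q q (\<delta>V y) = push ?V ?V (\<delta>V y)"
    using g_on V_on lin
    by (auto intro!: tensor_map_eq_push[OF g V \<Delta>E] tensor_map_eq_push[OF V g sE]
        tensor_map_eq_push[OF V V \<delta>V] simp del: comp_apply)
  \<comment> \<open>In each case a tensor factor from \<open>g\<close> meets \<open>?V\<close>,
    which vanishes there.\<close>
  have z: "push ?V ?V (\<Delta>E y) = 0" "push ?V ?V (swap (\<Delta>E y)) = 0" "push ?V ?V (\<Delta>V y) = 0"
    "push ?g ?V (swap (\<Delta>E y)) = 0" "push ?g ?V (\<Delta>V y) = 0"
    using g_on lin
    by (auto intro!: push_zero_on[OF \<Delta>E] push_zero_on[OF sE] push_zero_on[OF \<Delta>V]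
        simp del: comp_apply)
  have i: "push ?g ?g (\<Delta>V y) = \<Delta>V y"
    using g_on lin by (auto intro!: push_id_on[OF \<Delta>V] simp del: comp_apply)
  have c: "push \<alpha> \<beta> t = push (\<alpha> \<circ> \<phi>) (\<beta> \<circ> \<phi>) (\<Delta>E y) - push (\<alpha> \<circ> \<phi>) (\<beta> \<circ> \<phi>) (swap (\<Delta>E y))
      + push (\<alpha> \<circ> \<phi>) (\<beta> \<circ> \<phi>) (\<Delta>V y) + push (\<alpha> \<circ> \<phi>) (\<beta> \<circ> \<phi>) (\<delta>V y)"
    if "linear_on UNIV scale \<alpha>" "linear_on UNIV scale \<beta>" for \<alpha> \<beta>
    by (simp only: t_def push_comp that U_V[OF y] push_add push_diff)
  show "push pV pV t = tensor_map V V q q (\<delta>V y)"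
    by (simp only: c linear_pV z m diff_0_right add_0)
  show "push pg pV t = tensor_map g V id q (\<Delta>E y) + tensor_map V V p q (\<delta>V y)"
    by (simp only: c linear_pg linear_pV z m diff_0_right add_0_right)
  show "push pg pg t = tensor_map g V id p (\<Delta>E y) - tensor_map V g p id (swap (\<Delta>E y))
      + tensor_map V V p p (\<delta>V y) + \<Delta>V y"
    by (simp only: c linear_pg m i ac_simps)
qed

end

section \<open>Extending structures give exactly the extensions\<close>

lemma LC_datum: "\<Omega> \<in> LC g \<delta>g V \<Longrightarrow> extending_datum g V \<Omega>"
  by (simp add: LC_def)

lemma U_in_extensions:
  assumes "\<Omega> \<in> LC g \<delta>g V"
  shows "U \<Omega> \<in> extensions g \<delta>g"
proof -
  obtain \<Delta>E \<Delta>V \<delta>V where \<Omega>: "\<Omega> = (\<Delta>E, \<Delta>V, \<delta>V)" by (cases \<Omega>)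
  have "U \<Omega> a = \<delta>g a" if "a \<in> g" for a
    using U_g LC_datum[OF assms] that unfolding \<Omega> by blast
  then show ?thesis
    using assms coalgebra by (simp add: extensions_def lie_subcoalgebra_def LC_def)
qed

lemma extension_eq_U:
  assumes "\<delta>E \<in> extensions g \<delta>g"
  shows "\<exists>\<Omega>\<in>LC g \<delta>g V. \<delta>E = U \<Omega>"
proof -
  have co: "lie_coalgebra UNIV \<delta>E" and on_g: "\<And>a. a \<in> g \<Longrightarrow> \<delta>E a = \<delta>g a"
    using assms by (auto simp: extensions_def lie_subcoalgebra_def)
  then have lin: "linear_on UNIV scale2 \<delta>E" and anti: "\<And>x. \<delta>E x = - swap (\<delta>E x)"
    by (auto simp: lie_coalgebra_def)
  \<comment> \<open>The choice is forced by \<open>U_components\<close> with a = 0. Restricting to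
    \<open>V\<close> supplies the normalisation outside \<open>V\<close> that
    \<open>lin_maps\<close> demands.\<close>
  define \<Omega> where "\<Omega> = (restrict (push pg pV \<circ> \<delta>E) V, restrict (push pg pg \<circ> \<delta>E) V,
    restrict (push pV pV \<circ> \<delta>E) V)"
  have "restrict (push \<phi> \<psi> \<circ> \<delta>E) V \<in> lin_maps scale2 V (tensor_space A B)"
    if "linear_on UNIV scale \<phi>" "linear_on UNIV scale \<psi>" "\<And>e. \<phi> e \<in> A" "\<And>e. \<psi> e \<in> B"
    for \<phi> \<psi> A B
    using push_in_tensor_space[OF extensions_tensor_space[OF assms] that(1,2)] that lin
      subspace_add[OF V] subspace_scale[OF V]
    by (auto simp: lin_maps_def linear_on_def push_add push_scale2)
  then have \<Omega>: "extending_datum g V \<Omega>"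
    by (simp add: \<Omega>_def extending_datum_def linear_pg linear_pV pg_in pV_in)
  have "U \<Omega> e = \<delta>E e" for e
  proof -
    obtain a x where e: "a \<in> g" "x \<in> V" "e = a + x" by (rule complement_cases)
    have "\<delta>E e = \<delta>g a + \<delta>E x" using lin e on_g by (simp add: linear_on_def)
    then show ?thesis
      using push_decomp_antisym[OF extensions_tensor_space[OF assms] anti, of x]
      by (simp add: e \<Omega>_def U_sum add.assoc add.commute add.left_commute diff_conv_add_uminus
        del: add_uminus_conv_diff)
  qed
  then have "\<delta>E = U \<Omega>" by (simp add: fun_eq_iff[of \<delta>E])
  \<comment> \<open>The Lie coalgebra axioms for the co-product come for free, since it is \<delta>E
    itself.\<close>
  then show ?thesis using \<Omega> co by (intro bexI[of _ \<Omega>]) (simp_all add: LC_def)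
qed

section \<open>Homomorphisms fixing \<open>g\<close> and equivalence of extending structures\<close>

text \<open>On \<open>g\<close> both co-products equal \<delta>g, so by additivity the equation only
  has content on \<open>V\<close>. There both sides are antisymmetric and can be compared in three
  blocks. Since \<phi> y = p y + q y, the g \<otimes> g block of the left side is \<delta>g (p y) +
  \<Delta>V' (q y).\<close>

lemma hom_iff_components:
  assumes LC: "(\<Delta>E, \<Delta>V, \<delta>V) \<in> LC g \<delta>g V" "(\<Delta>E', \<Delta>V', \<delta>V') \<in> LC g \<delta>g V"
    and \<phi>: "linear_on UNIV scale \<phi>" and on_g: "\<And>a. a \<in> g \<Longrightarrow> \<phi> a = a"
    and pq: "\<And>x. x \<in> V \<Longrightarrow> p x \<in> g \<and> q x \<in> V \<and> \<phi> x = p x + q x"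
  shows "(\<forall>e. U (\<Delta>E', \<Delta>V', \<delta>V') (\<phi> e) = push \<phi> \<phi> (U (\<Delta>E, \<Delta>V, \<delta>V) e)) \<longleftrightarrow>
    (\<forall>y\<in>V. \<delta>V' (q y) = tensor_map V V q q (\<delta>V y) \<and>
       \<Delta>E' (q y) = tensor_map g V id q (\<Delta>E y) + tensor_map V V p q (\<delta>V y) \<and>
       \<Delta>V' (q y) = tensor_map g V id p (\<Delta>E y) - tensor_map V g p id (swap (\<Delta>E y))
                + tensor_map V V p p (\<delta>V y) + \<Delta>V y - \<delta>g (p y))"
    (is "(\<forall>e. ?U' (\<phi> e) = push \<phi> \<phi> (?U e)) \<longleftrightarrow> (\<forall>y\<in>V. ?C y)")
proof -
  note ext = U_in_extensions[OF LC(1)] U_in_extensions[OF LC(2)]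
  have lin: "linear_on UNIV scale2 ?U" "linear_on UNIV scale2 ?U'"
    and anti: "\<And>e. ?U e = - swap (?U e)" "\<And>e. ?U' e = - swap (?U' e)"
    using LC by (simp_all add: LC_def lie_coalgebra_def)
  have on_V: "?U' (\<phi> y) = push \<phi> \<phi> (?U y) \<longleftrightarrow> ?C y" if y: "y \<in> V" for y
  proof -
    let ?t = "push \<phi> \<phi> (?U y)"
    have t: "?t \<in> tensor_space UNIV UNIV"
      by (rule push_in_tensor_space[OF extensions_tensor_space[OF ext(1)] \<phi> \<phi>]) auto
    have at: "?t = - swap ?t"
      by (subst anti(1)) (simp only: push_simps)
    have "?U' (\<phi> y) = ?t \<longleftrightarrow> push pV pV (?U' (\<phi> y)) = push pV pV ?t \<and>
      push pg pV (?U' (\<phi> y)) = push pg pV ?t \<and> push pg pg (?U' (\<phi> y)) = push pg pg ?t"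
      using push_decomp_antisym[OF t at]
        push_decomp_antisym[OF extensions_tensor_space[OF ext(2)] anti(2), of "\<phi> y"]
      by metis
    moreover have "\<phi> y = p y + q y" "p y \<in> g" "q y \<in> V" using pq[OF y] by auto
    ultimately show ?thesis
      using U_components[OF LC_datum[OF LC(2)]]
        push_U_components[OF LC_datum[OF LC(1)] \<phi> on_g pq y]
      by (simp add: algebra_simps eq_diff_eq)
  qed
  have "?U' (\<phi> e) = push \<phi> \<phi> (?U e)" if V: "\<And>y. y \<in> V \<Longrightarrow> ?U' (\<phi> y) = push \<phi> \<phi> (?U y)" for e
  proof -
    obtain a x where e: "a \<in> g" "x \<in> V" "e = a + x" by (rule complement_cases)
    have "?U e = \<delta>g a + ?U x" "?U' (\<phi> e) = \<delta>g a + ?U' (\<phi> x)"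
      using lin \<phi> U_g[OF LC_datum[OF LC(1)] e(1)] U_g[OF LC_datum[OF LC(2)] e(1)] on_g[OF e(1)]
      by (simp_all add: linear_on_def e(3))
    then show ?thesis
      using V[OF e(2)] push_id_on[OF \<delta>g_in[OF e(1)] \<phi> \<phi> on_g on_g] by (simp add: push_add)
  qed
  then show ?thesis using on_V by blast
qed

text \<open>With respect to E = g \<oplus> V the map \<phi> is block triangular, with the identity
  and \<open>q\<close> on the diagonal.\<close>

lemma bij_iff_bij_betw:
  assumes \<phi>: "linear_on UNIV scale \<phi>" and on_g: "\<And>a. a \<in> g \<Longrightarrow> \<phi> a = a"
    and pq: "\<And>x. x \<in> V \<Longrightarrow> p x \<in> g \<and> q x \<in> V \<and> \<phi> x = p x + q x"
  shows "bij \<phi> \<longleftrightarrow> bij_betw q V V"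
proof
  have \<phi>_sum: "\<phi> (a + x) = (a + p x) + q x" "a + p x \<in> g" "q x \<in> V" if "a \<in> g" "x \<in> V" for a x
    using \<phi> on_g pq that subspace_add[OF g] by (auto simp: linear_on_def add.assoc)
  {
    assume b: "bij \<phi>"
    show "bij_betw q V V"
    proof (rule bij_betwI')
      fix x y assume xy: "x \<in> V" "y \<in> V"
      have "x = y" if "q x = q y"
      proof -
        \<comment> \<open>If q x = q y, the images of x and y differ by this element of
          \<open>g\<close>, which \<phi> fixes; adding it to x gives the same image as y.\<close>
        have "p y - p x \<in> g" using pq xy subspace_diff[OF g] by blast
        then have "\<phi> ((p y - p x) + x) = \<phi> (0 + y)"
          using \<phi>_sum xy that subspace_0[OF g] by (metis add_0 diff_add_cancel)
        then have "(p y - p x) + x = 0 + y" using b by (auto simp: bij_def dest: injD)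
        then show ?thesis
          using pV_sum \<open>p y - p x \<in> g\<close> subspace_0[OF g] xy by metis
      qed
      then show "q x = q y \<longleftrightarrow> x = y" by blast
    next
      fix x assume "x \<in> V" then show "q x \<in> V" using pq by blast
    next
      fix w assume w: "w \<in> V"
      obtain e where e: "\<phi> e = w" using b by (metis bij_pointE)
      obtain a x where ax: "a \<in> g" "x \<in> V" "e = a + x" by (rule complement_cases)
      have "pV w = q x" using \<phi>_sum[OF ax(1,2)] pV_sum e ax(3) by metis
      then show "\<exists>x\<in>V. w = q x" using ax w pV_V by auto
    qed
  next
    assume b: "bij_betw q V V"
    have "e = e'" if "\<phi> e = \<phi> e'" for e e'
    proof -
      obtain a x where ax: "a \<in> g" "x \<in> V" "e = a + x" by (rule complement_cases)
      obtain a' x' where ax': "a' \<in> g" "x' \<in> V" "e' = a' + x'" by (rule complement_cases)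
      have s: "(a + p x) + q x = (a' + p x') + q x'" using that \<phi>_sum ax ax' by metis
      then have "q x = q x'" using pV_sum \<phi>_sum ax(1,2) ax'(1,2) by metis
      then have "x = x'" using b ax ax' by (auto simp: bij_betw_def dest: inj_onD)
      then show ?thesis using s ax ax' by simp
    qed
    moreover have "\<exists>e. w = \<phi> e" for w
    proof -
      obtain a x where ax: "a \<in> g" "x \<in> V" "w = a + x" by (rule complement_cases)
      obtain y where y: "y \<in> V" "x = q y" using b ax by (auto simp: bij_betw_def)
      \<comment> \<open>The contribution p y of y to the \<open>g\<close> part is subtracted in
        advance.\<close>
      have "a - p y \<in> g" using pq y ax subspace_diff[OF g] by blast
      then have "\<phi> ((a - p y) + y) = w" using \<phi>_sum y ax by simp
      then show ?thesis by blast
    qed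
    ultimately show "bij \<phi>" by (auto simp: bij_def inj_def surj_def)
  }
qed

text \<open>Pairs (p, q) as in the equivalence of extending structures correspond to linear
  bijections \<phi> fixing \<open>g\<close>, and under this correspondence the formulas say that
  \<phi> is a homomorphism of co-products.\<close>

lemma LC_equiv_iff:
  "(\<Omega>, \<Omega>') \<in> LC_equiv g \<delta>g V \<longleftrightarrow>
    \<Omega> \<in> LC g \<delta>g V \<and> \<Omega>' \<in> LC g \<delta>g V \<and> (U \<Omega>, U \<Omega>') \<in> ext_equiv g \<delta>g"
proof -
  obtain \<Delta>E \<Delta>V \<delta>V where \<Omega>: "\<Omega> = (\<Delta>E, \<Delta>V, \<delta>V)" by (cases \<Omega>)
  obtain \<Delta>E' \<Delta>V' \<delta>V' where \<Omega>': "\<Omega>' = (\<Delta>E', \<Delta>V', \<delta>V')" by (cases \<Omega>')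
  define C where "C p q y x \<longleftrightarrow> \<delta>V' x = tensor_map V V q q (\<delta>V y) \<and>
       \<Delta>E' x = tensor_map g V id q (\<Delta>E y) + tensor_map V V p q (\<delta>V y) \<and>
       \<Delta>V' x = tensor_map g V id p (\<Delta>E y) - tensor_map V g p id (swap (\<Delta>E y))
                + tensor_map V V p p (\<delta>V y) + \<Delta>V y - \<delta>g (p y)" for p q y x
  \<comment> \<open>Substituting x = q y removes the inverse of \<open>q\<close> from the
    formulas.\<close>
  have C: "(\<forall>x\<in>V. C p q (inv_into V q x) x) \<longleftrightarrow> (\<forall>y\<in>V. C p q y (q y))"
    if "bij_betw q V V" for p q
    using that
    by (metis bij_betw_apply bij_betw_inv_into_left bij_betw_inv_into_right bij_betw_inv_into)
  have LC_equiv: "(\<Omega>, \<Omega>') \<in> LC_equiv g \<delta>g V \<longleftrightarrow> \<Omega> \<in> LC g \<delta>g V \<and> \<Omega>' \<in> LC g \<delta>g V \<and>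
    (\<exists>p\<in>lin_maps scale V g. \<exists>q\<in>lin_maps scale V V. bij_betw q V V \<and> (\<forall>y\<in>V. C p q y (q y)))"
    unfolding LC_equiv_def \<Omega> \<Omega>'
    by (simp add: C_def[symmetric] Let_def C cong: conj_cong)
  show ?thesis
  proof (cases "\<Omega> \<in> LC g \<delta>g V \<and> \<Omega>' \<in> LC g \<delta>g V")
    case True
    then have LC: "(\<Delta>E, \<Delta>V, \<delta>V) \<in> LC g \<delta>g V" "(\<Delta>E', \<Delta>V', \<delta>V') \<in> LC g \<delta>g V"
      by (simp_all add: \<Omega> \<Omega>')
    have iff: "bij \<phi> \<and> (\<forall>e. U \<Omega>' (\<phi> e) = push \<phi> \<phi> (U \<Omega> e)) \<longleftrightarrow>
        bij_betw q V V \<and> (\<forall>y\<in>V. C p q y (q y))"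
      if "linear_on UNIV scale \<phi>" "\<And>a. a \<in> g \<Longrightarrow> \<phi> a = a"
        "\<And>x. x \<in> V \<Longrightarrow> p x \<in> g \<and> q x \<in> V \<and> \<phi> x = p x + q x" for \<phi> p q
      using hom_iff_components[OF LC that] bij_iff_bij_betw[OF that]
      by (simp add: C_def \<Omega> \<Omega>')
    have "(\<exists>p\<in>lin_maps scale V g. \<exists>q\<in>lin_maps scale V V.
          bij_betw q V V \<and> (\<forall>y\<in>V. C p q y (q y))) \<longleftrightarrow>
        (\<exists>\<phi>. linear_on UNIV scale \<phi> \<and> bij \<phi> \<and> (\<forall>x\<in>g. \<phi> x = x) \<and>
          (\<forall>e. U \<Omega>' (\<phi> e) = push \<phi> \<phi> (U \<Omega> e)))" (is "?L \<longleftrightarrow> ?R")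
    proof
      assume ?L
      then obtain p q where p: "p \<in> lin_maps scale V g" and q: "q \<in> lin_maps scale V V"
        and c: "bij_betw q V V \<and> (\<forall>y\<in>V. C p q y (q y))" by blast
      \<comment> \<open>This is a + x \<mapsto> a + p x + q x, written with the projections so that
        linearity follows from that of each summand.\<close>
      define \<phi> where "\<phi> = (\<lambda>e. pg e + (p \<circ> pV) e + (q \<circ> pV) e)"
      have l: "linear_on V scale p" "linear_on V scale q"
        and im: "\<And>x. x \<in> V \<Longrightarrow> p x \<in> g" "\<And>x. x \<in> V \<Longrightarrow> q x \<in> V"
        using p q by (auto simp: lin_maps_def)
      have "p 0 = 0" "q 0 = 0"
        using linear_on_sum_list[OF V vector_space_axioms l(1), of "[]"]
          linear_on_sum_list[OF V vector_space_axioms l(2), of "[]"] by simp_all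
      then have \<phi>: "linear_on UNIV scale \<phi>" "\<And>a. a \<in> g \<Longrightarrow> \<phi> a = a"
        "\<And>x. x \<in> V \<Longrightarrow> p x \<in> g \<and> q x \<in> V \<and> \<phi> x = p x + q x"
        using linear_pg l[THEN linear_on_comp_pV] im
        by (auto simp: \<phi>_def linear_on_def pg_g pV_g pg_V pV_V scale_right_distrib)
      show ?R using iff[OF \<phi>] c \<phi> by blast
    next
      assume ?R
      then obtain \<phi> where \<phi>: "linear_on UNIV scale \<phi>" "\<And>a. a \<in> g \<Longrightarrow> \<phi> a = a"
        and h: "bij \<phi> \<and> (\<forall>e. U \<Omega>' (\<phi> e) = push \<phi> \<phi> (U \<Omega> e))" by blast
      \<comment> \<open>The two components of \<phi> on \<open>V\<close>, normalised outside
        \<open>V\<close> to be members of \<open>lin_maps\<close>.\<close>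
      define p q where "p = restrict (pg \<circ> \<phi>) V" and "q = restrict (pV \<circ> \<phi>) V"
      have pq: "\<And>x. x \<in> V \<Longrightarrow> p x \<in> g \<and> q x \<in> V \<and> \<phi> x = p x + q x"
        by (simp add: p_def q_def pg_in pV_in pg_add_pV)
      have "p \<in> lin_maps scale V g" "q \<in> lin_maps scale V V"
        using linear_on_comp[OF linear_pg \<phi>(1)] linear_on_comp[OF linear_pV \<phi>(1)]
          subspace_add[OF V] subspace_scale[OF V]
        by (auto simp: p_def q_def lin_maps_def linear_on_def pg_in pV_in)
      then show ?L using iff[OF \<phi> pq] h by blast
    qed
    then show ?thesis
      using True U_in_extensions by (simp add: LC_equiv ext_equiv_iff)
  qed (auto simp: LC_equiv)
qed

lemma U_image: "U ` LC g \<delta>g V = extensions g \<delta>g"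
  using U_in_extensions extension_eq_U by blast

end

theorem theorem3p8:
  fixes scale :: "'k::field_char_0 \<Rightarrow> 'e::ab_group_add \<Rightarrow> 'e"
    and g V :: "'e set"
    and \<delta>g :: "'e \<Rightarrow> ('k, 'e) tensor2"
  assumes "vector_space scale"
    and "vector_space.lie_coalgebra scale g \<delta>g"
    and "module.subspace scale V"
    and "g \<inter> V = {0}"
    and "{a + x | a x. a \<in> g \<and> x \<in> V} = UNIV"
  shows "equiv (vector_space.LC scale g \<delta>g V) (vector_space.LC_equiv scale g \<delta>g V) \<and>
    equiv (vector_space.extensions scale g \<delta>g) (vector_space.ext_equiv scale g \<delta>g) \<and>
    (\<exists>F. (\<forall>\<Omega> \<in> vector_space.LC scale g \<delta>g V.
            F (vector_space.LC_equiv scale g \<delta>g V `` {\<Omega>}) =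
              vector_space.ext_equiv scale g \<delta>g ``
                {vector_space.unified_coproduct g \<delta>g V \<Omega>}) \<and>
         bij_betw F (vector_space.HC2 scale g \<delta>g V) (vector_space.CExtd scale g \<delta>g))"
proof -
  interpret vector_space scale by fact
  interpret lie_coalgebra_complement scale g V \<delta>g
    by unfold_locales (fact assms)+
  \<comment> \<open>The relation on extending structures is the pullback along the surjection
    \<open>U\<close> of the relation on extensions, so the abstract quotient lemmas apply.\<close>
  show ?thesis
    using pullback_equiv[OF equiv_ext_equiv U_image LC_equiv_iff] equiv_ext_equiv
      pullback_quotient_bij[OF equiv_ext_equiv U_image LC_equiv_iff]
    by (simp add: HC2_def CExtd_def)
qed

end
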